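(* Consider an LTI filter $H:\mathbb{C}^N\to\mathbb{C}^N$ with impulse response $h\in\mathbb{C}^N$, and let $g_1,g_2\in\mathbb{C}^N$ satisfy $(\overline{\mathcal{I}g_1}\ast g_2)(u)\neq 0$ for every $u=0,\dots,N-1$. Then $H$ can be represented as a Gabor multiplier $\mathsf{G}^{g_1,g_2}_a$ with $\alpha=\beta=1$ and lower symbol $$a=\frac{1}{N^2}\left(\mathbf{1}\otimes\mathcal{F}_N\left(\frac{h}{\overline{\mathcal{I}g_1}\ast g_2}\right)\right).$$
   Context: $\mathbb{C}^N$ is identified with $\ell^2(\mathbb{Z}_N)$, and all indices are taken modulo $N$. For $f,g\in\mathbb{C}^N$: $T_kf(t)=f(t-k)$, $M_lf(t)=e^{2\pi i lt/N}f(t)$, $\pi(k,l)=M_lT_k$, $\mathcal{I}f(t)=f(-t)$, $(f\ast g)(u)=\sum_{k=0}^{N-1}f(u-k)g(k)$, $(f\otimes g)(u,v)=f(u)g(v)$; $\mathbf{1}\in\mathbb{C}^N$ is the constant vector equal to $1$; quotients of vectors are pointwise. The discrete Fourier transform is $\mathcal{F}_Nf(v)=\sum_{k=0}^{N-1}f(k)e^{-2\pi i kv/N}$, with inverse $\mathcal{F}_N^{-1}f(v)=\frac1N\sum_{k=0}^{N-1}f(k)e^{2\pi i kv/N}$. The short-time Fourier transform is $V_gf(u,v)=\sum_{k=0}^{N-1}f(k)\overline{g(k-u)}e^{-2\pi i kv/N}$. The LTI (linear time invariant) filter with impulse response $h$ is $Hf=h\ast f$. The Gabor multiplier with lattice constants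 $\alpha=\beta=1$, windows $g_1,g_2$ and lower symbol (mask) $a\in\mathbb{C}^{N\times N}$ is $\mathsf{G}^{g_1,g_2}_af=\sum_{k=0}^{N-1}\sum_{l=0}^{N-1}a(k,l)\,V_{g_1}f(k,l)\,\pi(k,l)g_2$.
   Formalization: The lower symbol carries the factor 1/N instead of the printed 1/N^2; with the stated unnormalised conventions the printed symbol yields (1/N)H, e.g. it fails for h = g_1 = delta_0, g_2 = 1 and N > 1. *)

theory Defs
  imports "HOL-Analysis.Analysis" "Berlekamp_Zassenhaus.Finite_Field"
begin

text \<open>
  The group Z_N is the type 'n mod_ring with N = CARD('n), so that arithmetic on indices is
  modulo N, and C^N is the space of vectors indexed by it. As 'n ranges over all finite types,
  N ranges over all positive integers. The integer representative of an index used in the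
  exponentials is the one in {0, ..., N - 1}; they do not depend on that choice.
\<close>

type_synonym 'n cvec = "complex ^ 'n mod_ring"

definition translation :: "'n::finite mod_ring \<Rightarrow> 'n cvec \<Rightarrow> 'n cvec" where
  "translation k f = (\<chi> t. f $ (t - k))"

definition modulation :: "'n::finite mod_ring \<Rightarrow> 'n cvec \<Rightarrow> 'n cvec" where
  "modulation l f = (\<chi> t.
     exp (2 * of_real pi * \<i> * of_int (to_int_mod_ring l) * of_int (to_int_mod_ring t)
            / of_nat CARD('n)) * f $ t)"

definition tf_shift :: "'n::finite mod_ring \<Rightarrow> 'n mod_ring \<Rightarrow> 'n cvec \<Rightarrow> 'n cvec" where
  "tf_shift k l f = modulation l (translation k f)"

definition reflection :: "'n::finite cvec \<Rightarrow> 'n cvec" where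
  "reflection f = (\<chi> t. f $ (- t))"

definition conj_vec :: "'n::finite cvec \<Rightarrow> 'n cvec" where
  "conj_vec f = (\<chi> t. cnj (f $ t))"

definition quot_vec :: "'n::finite cvec \<Rightarrow> 'n cvec \<Rightarrow> 'n cvec" where
  "quot_vec f g = (\<chi> t. f $ t / g $ t)"

definition convolution :: "'n::finite cvec \<Rightarrow> 'n cvec \<Rightarrow> 'n cvec" where
  "convolution f g = (\<chi> u. \<Sum>k\<in>UNIV. f $ (u - k) * g $ k)"

definition dft :: "'n::finite cvec \<Rightarrow> 'n cvec" where
  "dft f = (\<chi> v. \<Sum>k\<in>UNIV. f $ k *
     exp (- 2 * of_real pi * \<i> * of_int (to_int_mod_ring k) * of_int (to_int_mod_ring v)
            / of_nat CARD('n)))"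

text \<open>Elements of C^(N x N) are matrices with a(u,v) = a $ u $ v.\<close>

definition tensor :: "'n::finite cvec \<Rightarrow> 'n cvec \<Rightarrow> complex ^ 'n mod_ring ^ 'n mod_ring" where
  "tensor f g = (\<chi> u v. f $ u * g $ v)"

definition stft ::
  "'n::finite cvec \<Rightarrow> 'n cvec \<Rightarrow> complex ^ 'n mod_ring ^ 'n mod_ring" where
  "stft g f = (\<chi> u v. \<Sum>k\<in>UNIV. f $ k * cnj (g $ (k - u)) *
     exp (- 2 * of_real pi * \<i> * of_int (to_int_mod_ring k) * of_int (to_int_mod_ring v)
            / of_nat CARD('n)))"

definition lti_filter :: "'n::finite cvec \<Rightarrow> 'n cvec \<Rightarrow> 'n cvec" where
  "lti_filter h f = convolution h f"

text \<open>
  The Gabor multiplier on the full lattice (both lattice constants equal to 1). Neither the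
  transform nor this synthesis sum is normalised. The sum over all frequencies of dft f
  against exp(2 pi i l v / N) is N * f(v), so a mask of the form tensor 1 (dft (quot_vec h c))
  needs the factor 1 / N to reproduce the filter h when c is the convolution of the conjugated
  reflected analysis window with the synthesis window. The factor 1 / N^2 that appears in the
  source would, with these conventions, yield 1 / N times the filter.
\<close>

definition gabor_multiplier ::
  "'n::finite cvec \<Rightarrow> 'n cvec \<Rightarrow> complex ^ 'n mod_ring ^ 'n mod_ring \<Rightarrow> 'n cvec \<Rightarrow> 'n cvec" where
  "gabor_multiplier g1 g2 a f =
     (\<Sum>k\<in>UNIV. \<Sum>l\<in>UNIV. (a $ k $ l * stft g1 f $ k $ l) *s tf_shift k l g2)"

end

theory Submission
  imports Defs
begin

text \<open>
  For a mask of the form \<open>tensor 1 (dft q)\<close> the frequency sum in the Gabor multiplier collapses, by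
  orthogonality of characters, to the constraint that the lag \<open>t - s\<close> between output and input
  equals the argument of \<open>q\<close>. The remaining sum over translates of the windows depends on
  \<open>t - s\<close> only and is the convolution \<open>c\<close> of the conjugated reflected analysis window with the
  synthesis window. Hence the multiplier is the filter with impulse response \<open>N q c\<close>, and
  \<open>q = h / c\<close> gives the claim.
\<close>

text \<open>Naming the exponential confines integer representatives to a few lemmas; the rest uses
  only that it is a symmetric bicharacter of the index group.\<close>

definition character :: "'n::finite mod_ring \<Rightarrow> 'n mod_ring \<Rightarrow> complex" where
  "character l t =
     exp (2 * of_real pi * \<i> * of_int (to_int_mod_ring l) * of_int (to_int_mod_ring t)
            / of_nat CARD('n))"

lemma exp_root_of_unity_eq_iff:
  fixes a b :: int and n :: nat
  assumes "n > 0"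
  shows "exp (2 * of_real pi * \<i> * of_int a / of_nat n) =
         exp (2 * of_real pi * \<i> * of_int b / of_nat n) \<longleftrightarrow> int n dvd a - b"
proof -
  have "2 * of_real pi * \<i> * of_int a / of_nat n =
        2 * of_real pi * \<i> * of_int b / of_nat n + (of_int (2 * k) * of_real pi) * \<i> \<longleftrightarrow>
        a - b = int n * k" for k :: int
  proof -
    have "2 * of_real pi * \<i> * of_int a / of_nat n =
          2 * of_real pi * \<i> * of_int b / of_nat n + (of_int (2 * k) * of_real pi) * \<i> \<longleftrightarrow>
          (2 * of_real pi * \<i>) * of_int a = (2 * of_real pi * \<i>) * (of_int (b + int n * k) :: complex)"
      using assms by (simp add: field_simps)
    also have "\<dots> \<longleftrightarrow> (of_int a :: complex) = of_int (b + int n * k)"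
      by simp
    also have "\<dots> \<longleftrightarrow> a = b + int n * k"
      by (rule of_int_eq_iff)
    finally show ?thesis by auto
  qed
  then show ?thesis
    unfolding exp_eq dvd_def by simp
qed

lemma character_0 [simp]: "character 0 t = 1" "character l 0 = 1"
  by (simp_all add: character_def)

lemma character_commute: "character l t = character t l"
  by (simp add: character_def mult_ac)

text \<open>The representative of \<open>s + t\<close> differs from the sum of the representatives
  by a multiple of \<open>CARD('n)\<close>, which the exponential does not see.\<close>

lemma character_add_right: "character l (s + t) = character l s * character l t"
  for l s t :: "'n::finite mod_ring"
proof -
  let ?l = "to_int_mod_ring l" and ?s = "to_int_mod_ring s" and ?t = "to_int_mod_ring t"
  have "to_int_mod_ring (s + t) = (?s + ?t) mod int CARD('n)"
    by transfer simp
  then have "int CARD('n) dvd ?l * to_int_mod_ring (s + t) - ?l * (?s + ?t)"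
    by (metis dvd_mult mod_eq_dvd_iff mod_mod_trivial right_diff_distrib)
  then have "exp (2 * of_real pi * \<i> * of_int (?l * to_int_mod_ring (s + t)) / of_nat CARD('n)) =
             exp (2 * of_real pi * \<i> * of_int (?l * (?s + ?t)) / of_nat CARD('n))"
    by (subst exp_root_of_unity_eq_iff) auto
  then show ?thesis
    by (simp add: character_def exp_add [symmetric] ring_distribs add_divide_distrib mult.assoc)
qed

lemma character_add_left: "character (k + l) t = character k t * character l t"
  by (metis character_add_right character_commute)

lemma character_diff_right: "character l (s - t) = character l s * character l (- t)"
  using character_add_right[of l s "- t"] by simp

lemma character_minus_mult: "character l (- t) * character l t = 1"
  by (metis character_0(2) character_add_right ab_left_minus)

text \<open>The representative of \<open>- k\<close> is in general not minus that of
  \<open>k\<close>, so the exponents are not compared: both sides are inverse to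
  \<open>character v k\<close>.\<close>

lemma exp_minus_eq_character:
  "exp (- 2 * of_real pi * \<i> * of_int (to_int_mod_ring k) * of_int (to_int_mod_ring v)
          / of_nat CARD('n)) = character v (- k)"
  for k v :: "'n::finite mod_ring"
proof -
  have "exp (- 2 * of_real pi * \<i> * of_int (to_int_mod_ring k) * of_int (to_int_mod_ring v)
          / of_nat CARD('n)) * character v k = 1"
    by (simp add: character_def exp_add [symmetric] mult_ac)
  then show ?thesis
    by (metis character_minus_mult mult_right_cancel mult_zero_right zero_neq_one)
qed

lemma dft_eq_character: "dft q $ l = (\<Sum>k\<in>UNIV. q $ k * character l (- k))"
  unfolding dft_def vec_lambda_beta exp_minus_eq_character ..

lemma stft_eq_character:
  "stft g f $ k $ l = (\<Sum>s\<in>UNIV. f $ s * cnj (g $ (s - k)) * character l (- s))"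
  unfolding stft_def vec_lambda_beta exp_minus_eq_character ..

lemma tf_shift_eq_character: "tf_shift k l g $ t = character l t * g $ (t - k)"
  by (simp add: tf_shift_def modulation_def translation_def character_def)

lemma character_nontrivial:
  fixes t :: "'n::finite mod_ring"
  assumes "t \<noteq> 0"
  obtains l :: "'n mod_ring" where "character l t \<noteq> 1"
proof
  let ?t = "to_int_mod_ring t"
  have t: "0 < ?t" "?t < int CARD('n)"
    using assms by (transfer; simp)+
  \<comment> \<open>The witness is frequency one. A nonzero \<open>t\<close> forces
    \<open>CARD('n) > 1\<close>, so the residue of 1 has representative 1.\<close>
  then have "to_int_mod_ring (of_int_mod_ring 1 :: 'n mod_ring) = 1"
    by (intro to_int_mod_ring_of_int_mod_ring) auto
  then have "character (of_int_mod_ring 1) t = exp (2 * of_real pi * \<i> * of_int ?t / of_nat CARD('n))"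
    by (simp add: character_def)
  moreover have "\<not> int CARD('n) dvd ?t"
    using t by (auto dest: zdvd_imp_le)
  ultimately show "character (of_int_mod_ring 1) t \<noteq> 1"
    using exp_root_of_unity_eq_iff[of "CARD('n)" ?t 0] by simp
qed

text \<open>Shifting the summation index by \<open>m\<close> multiplies the sum by
  \<open>character m t\<close>; if this is not 1, the sum vanishes.\<close>

lemma sum_character:
  fixes t :: "'n::finite mod_ring"
  shows "(\<Sum>l\<in>UNIV. character l t) = (if t = 0 then of_nat CARD('n) else 0)"
proof (cases "t = 0")
  case False
  then obtain m where m: "character m t \<noteq> 1"
    by (rule character_nontrivial)
  have "(\<Sum>l\<in>UNIV. character l t) = (\<Sum>l\<in>UNIV. character (m + l) t)"
    by (rule sum.reindex_bij_witness[of _ "\<lambda>l. m + l" "\<lambda>l. l - m"]) auto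
  also have "\<dots> = character m t * (\<Sum>l\<in>UNIV. character l t)"
    by (simp add: character_add_left sum_distrib_left)
  finally show ?thesis
    using m False by simp
qed simp

text \<open>Fourier inversion without normalisation, the source of the factor
  \<open>CARD('n)\<close> in the multiplier.\<close>

lemma sum_dft_character:
  fixes q :: "'n::finite cvec"
  shows "(\<Sum>l\<in>UNIV. dft q $ l * character l t) = of_nat CARD('n) * q $ t"
proof -
  have "(\<Sum>l\<in>UNIV. dft q $ l * character l t) =
        (\<Sum>l\<in>UNIV. \<Sum>k\<in>UNIV. q $ k * character l (t - k))"
    by (simp add: dft_eq_character character_diff_right sum_distrib_left mult_ac)
  also have "\<dots> = (\<Sum>k\<in>UNIV. q $ k * (\<Sum>l\<in>UNIV. character l (t - k)))"
    by (subst sum.swap) (simp add: sum_distrib_left)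
  also have "\<dots> = (\<Sum>k\<in>UNIV. if k = t then q $ k * of_nat CARD('n) else 0)"
    by (intro sum.cong) (auto simp: sum_character)
  finally show ?thesis
    by (simp add: mult.commute)
qed

text \<open>Substituting \<open>t - k\<close> for \<open>k\<close> shows that the window sum over
  translates, as met in the multiplier, depends only on the lag \<open>t - s\<close>.\<close>

lemma convolution_conj_reflection:
  "convolution (conj_vec (reflection g1)) g2 $ (t - s) =
     (\<Sum>k\<in>UNIV. cnj (g1 $ (s - k)) * g2 $ (t - k))"
  unfolding convolution_def conj_vec_def reflection_def vec_lambda_beta
  by (rule sum.reindex_bij_witness[of _ "\<lambda>k. t - k" "\<lambda>k. t - k"]) (auto simp: algebra_simps)

lemma gabor_multiplier_tensor_dft:
  fixes f g1 g2 q :: "'n::finite cvec"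
  shows "gabor_multiplier g1 g2 (c *\<^sub>R tensor 1 (dft q)) f $ t =
    of_real c * of_nat CARD('n) *
      (\<Sum>s\<in>UNIV. q $ (t - s) * convolution (conj_vec (reflection g1)) g2 $ (t - s) * f $ s)"
proof -
  have "gabor_multiplier g1 g2 (c *\<^sub>R tensor 1 (dft q)) f $ t =
    (\<Sum>k\<in>UNIV. \<Sum>l\<in>UNIV. \<Sum>s\<in>UNIV. of_real c * (f $ s * cnj (g1 $ (s - k)) * g2 $ (t - k)) *
       (dft q $ l * character l (t - s)))"
    unfolding gabor_multiplier_def sum_component
    by (intro sum.cong refl)
      (simp add: tensor_def stft_eq_character tf_shift_eq_character character_diff_right
        sum_distrib_left sum_distrib_right scaleR_conv_of_real[where 'a = complex] mult_ac)
  \<comment> \<open>The mask is constant in the time variable \<open>k\<close>, so the sum over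
    \<open>l\<close> can be moved innermost and evaluated by inversion.\<close>
  also have "\<dots> = (\<Sum>k\<in>UNIV. \<Sum>s\<in>UNIV. of_real c * (f $ s * cnj (g1 $ (s - k)) * g2 $ (t - k)) *
       (\<Sum>l\<in>UNIV. dft q $ l * character l (t - s)))"
    unfolding sum_distrib_left by (rule sum.cong[OF refl], rule sum.swap)
  also have "\<dots> = (\<Sum>s\<in>UNIV. \<Sum>k\<in>UNIV. of_real c * (f $ s * cnj (g1 $ (s - k)) * g2 $ (t - k)) *
       (of_nat CARD('n) * q $ (t - s)))"
    unfolding sum_dft_character by (rule sum.swap)
  finally show ?thesis
    by (simp add: convolution_conj_reflection sum_distrib_left sum_distrib_right mult_ac)
qed

theorem theorem6p8:
  fixes H :: "'n::finite cvec \<Rightarrow> 'n cvec" and h g1 g2 :: "'n cvec"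
  assumes "H = lti_filter h"
    and "\<And>u. convolution (conj_vec (reflection g1)) g2 $ u \<noteq> 0"
  shows "H = gabor_multiplier g1 g2
           ((1 / real CARD('n)) *\<^sub>R
              tensor 1 (dft (quot_vec h (convolution (conj_vec (reflection g1)) g2))))"
proof (intro ext vec_eq_iff[THEN iffD2] allI)
  fix f t
  show "H f $ t = gabor_multiplier g1 g2
           ((1 / real CARD('n)) *\<^sub>R
              tensor 1 (dft (quot_vec h (convolution (conj_vec (reflection g1)) g2)))) f $ t"
    \<comment> \<open>The scalar cancels the \<open>CARD('n)\<close> from inversion, and as the
      window convolution has no zero, multiplying the quotient by it returns
      \<open>h\<close>.\<close>
    unfolding gabor_multiplier_tensor_dft
    using assms(2) by (simp add: assms(1) lti_filter_def quot_vec_def convolution_def[of h])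
qed

end
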